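(* Let $M\subset\mathbb{C}$ be a connected, simply connected domain and $L=1+\mathrm{i}e_1\in\mathbb{H}_{\mathbb{C}}$. For every holomorphic function $p\colon M\to\mathbb{C}$, the maps $$U_p:=1+p\,(e_3-\mathrm{i}e_2),\qquad V_p:=1+p\,(e_3+\mathrm{i}e_2)$$ take values in $\operatorname{Sp}(1,\mathbb{C})$ and satisfy $U_pL=L$ and $LV_p=L$. Consequently, if $\Phi=ALB$ with $A,B\colon M\to\operatorname{Sp}(1,\mathbb{C})$ holomorphic, then also $$\Phi=(AU_p)LB\qquad\text{and}\qquad\Phi=AL(V_pB).$$
   Context: $\mathbb{H}_{\mathbb{C}}:=\mathbb{H}\otimes_{\mathbb{R}}\mathbb{C}$ is the algebra of complex quaternions: elements $q=q_0+q_1e_1+q_2e_2+q_3e_3$ with $q_j\in\mathbb{C}$, where the imaginary unit $\mathrm{i}\in\mathbb{C}$ commutes with $e_1,e_2,e_3$, and $e_1^2=e_2^2=e_3^2=-1$, $e_1e_2=e_3=-e_2e_1$, $e_2e_3=e_1=-e_3e_2$, $e_3e_1=e_2=-e_1e_3$. The conjugate is $q^c:=q_0-q_1e_1-q_2e_2-q_3e_3$ and the symmetrised norm is $q^s:=qq^c=q_0^2+q_1^2+q_2^2+q_3^2$. $\operatorname{Sp}(1,\mathbb{C}):=\{q\in\mathbb{H}_{\mathbb{C}}: q^s=1\}$. *)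

theory Defs
  imports "HOL-Complex_Analysis.Complex_Analysis"
begin

text \<open>
  The complex quaternions: \<open>HC q0 q1 q2 q3\<close> is the element
  \<open>q0 + q1 e1 + q2 e2 + q3 e3\<close> with complex coefficients.
\<close>

datatype hc = HC (hc0: complex) (hc1: complex) (hc2: complex) (hc3: complex)

instantiation hc :: ring_1
begin

definition zero_hc :: hc where
  "0 = HC 0 0 0 0"

definition one_hc :: hc where
  "1 = HC 1 0 0 0"

definition plus_hc :: "hc \<Rightarrow> hc \<Rightarrow> hc" where
  "x + y = HC (hc0 x + hc0 y) (hc1 x + hc1 y) (hc2 x + hc2 y) (hc3 x + hc3 y)"

definition uminus_hc :: "hc \<Rightarrow> hc" where
  "- x = HC (- hc0 x) (- hc1 x) (- hc2 x) (- hc3 x)"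

definition minus_hc :: "hc \<Rightarrow> hc \<Rightarrow> hc" where
  "x - y = HC (hc0 x - hc0 y) (hc1 x - hc1 y) (hc2 x - hc2 y) (hc3 x - hc3 y)"

text \<open>The complex-bilinear extension of the multiplication table, which is proved
  below as \<open>hc_table\<close>.\<close>

definition times_hc :: "hc \<Rightarrow> hc \<Rightarrow> hc" where
  "x * y = HC
     (hc0 x * hc0 y - hc1 x * hc1 y - hc2 x * hc2 y - hc3 x * hc3 y)
     (hc0 x * hc1 y + hc1 x * hc0 y + hc2 x * hc3 y - hc3 x * hc2 y)
     (hc0 x * hc2 y - hc1 x * hc3 y + hc2 x * hc0 y + hc3 x * hc1 y)
     (hc0 x * hc3 y + hc1 x * hc2 y - hc2 x * hc1 y + hc3 x * hc0 y)"

instance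
  by standard
    (simp_all add: zero_hc_def one_hc_def plus_hc_def uminus_hc_def minus_hc_def
      times_hc_def algebra_simps)

end

text \<open>The embedding of the complex numbers as a central subring; complex scalars act
  through it.\<close>

definition hc_of :: "complex \<Rightarrow> hc" where
  "hc_of c = HC c 0 0 0"

definition e1 :: hc where "e1 = HC 0 1 0 0"
definition e2 :: hc where "e2 = HC 0 0 1 0"
definition e3 :: hc where "e3 = HC 0 0 0 1"

definition hc_cnj :: "hc \<Rightarrow> hc" where
  "hc_cnj q = HC (hc0 q) (- hc1 q) (- hc2 q) (- hc3 q)"

text \<open>The symmetrised norm, as an element of the algebra; by \<open>hc_symm_eq\<close> it is
  a complex scalar.\<close>

definition hc_symm :: "hc \<Rightarrow> hc" where
  "hc_symm q = q * hc_cnj q"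

definition Sp1C :: "hc set" where
  "Sp1C = {q. hc_symm q = 1}"

text \<open>\<open>holomorphic_on\<close> is only available for complex-valued functions, so
  holomorphy into the four-dimensional complex space \<open>hc\<close> is componentwise.\<close>

definition hc_holomorphic_on :: "(complex \<Rightarrow> hc) \<Rightarrow> complex set \<Rightarrow> bool" where
  "hc_holomorphic_on F M \<longleftrightarrow>
     (\<lambda>z. hc0 (F z)) holomorphic_on M \<and> (\<lambda>z. hc1 (F z)) holomorphic_on M \<and>
     (\<lambda>z. hc2 (F z)) holomorphic_on M \<and> (\<lambda>z. hc3 (F z)) holomorphic_on M"

definition hcL :: hc where
  "hcL = 1 + hc_of \<i> * e1"

definition hcU :: "(complex \<Rightarrow> complex) \<Rightarrow> complex \<Rightarrow> hc" where
  "hcU p z = 1 + hc_of (p z) * (e3 - hc_of \<i> * e2)"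

definition hcV :: "(complex \<Rightarrow> complex) \<Rightarrow> complex \<Rightarrow> hc" where
  "hcV p z = 1 + hc_of (p z) * (e3 + hc_of \<i> * e2)"

lemmas hc_defs = zero_hc_def one_hc_def plus_hc_def uminus_hc_def minus_hc_def
  times_hc_def hc_of_def e1_def e2_def e3_def hc_cnj_def

lemma hc_expand:
  "q = hc_of (hc0 q) + hc_of (hc1 q) * e1 + hc_of (hc2 q) * e2 + hc_of (hc3 q) * e3"
  by (simp add: hc_defs)

lemma hc_table:
  "e1 * e1 = -1" "e2 * e2 = -1" "e3 * e3 = -1"
  "e1 * e2 = e3" "e2 * e1 = - e3"
  "e2 * e3 = e1" "e3 * e2 = - e1"
  "e3 * e1 = e2" "e1 * e3 = - e2"
  by (simp_all add: hc_defs)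

lemma hc_of_central: "hc_of c * q = q * hc_of c"
  by (simp add: hc_defs mult.commute)

lemma hc_of_hom:
  "hc_of (a + b) = hc_of a + hc_of b" "hc_of (a * b) = hc_of a * hc_of b" "hc_of 1 = 1"
  by (simp_all add: hc_defs)

lemma hc_symm_eq:
  "hc_symm q = hc_of ((hc0 q)\<^sup>2 + (hc1 q)\<^sup>2 + (hc2 q)\<^sup>2 + (hc3 q)\<^sup>2)"
  by (simp add: hc_symm_def hc_defs power2_eq_square)

end

theory Submission imports Defs begin

text \<open>
  The elements \<open>e3 - \<i> e2\<close> and \<open>e3 + \<i> e2\<close> are isotropic (\<open>1 + \<i>\<^sup>2 = 0\<close>) with
  vanishing scalar part, so adding a multiple of them to \<open>1\<close> keeps the symmetrised norm \<open>1\<close>;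
  and they annihilate the zero divisor \<open>L\<close> from the left and from the right respectively.
\<close>

lemma hcU_in_Sp1C: "hcU p z \<in> Sp1C"
  by (simp add: Sp1C_def hc_symm_eq hcU_def hc_defs power_mult_distrib)

lemma hcV_in_Sp1C: "hcV p z \<in> Sp1C"
  by (simp add: Sp1C_def hc_symm_eq hcV_def hc_defs power_mult_distrib)

text \<open>Expanding \<open>(e3 - \<i> e2) * (1 + \<i> e1)\<close>, the terms
  \<open>\<i> e3 e1 = \<i> e2\<close> and \<open>-\<i>\<i> e2 e1 = - e3\<close> cancel the other
  two.\<close>

lemma hcU_mult_hcL: "hcU p z * hcL = hcL"
  by (simp add: hcU_def hcL_def hc_defs complex_eq_iff)

text \<open>Mirror image: here \<open>\<i> e1 e3 = -\<i> e2\<close> and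
  \<open>\<i>\<i> e1 e2 = - e3\<close> cancel \<open>\<i> e2\<close> and \<open>e3\<close>.\<close>

lemma hcL_mult_hcV: "hcL * hcV p z = hcL"
  by (simp add: hcV_def hcL_def hc_defs complex_eq_iff)

theorem proposition5p1:
  fixes M :: "complex set" and p :: "complex \<Rightarrow> complex"
  assumes "open M" and "M \<noteq> {}" and "connected M" and "simply_connected M"
    and "p holomorphic_on M"
  shows "(\<forall>z\<in>M. hcU p z \<in> Sp1C \<and> hcV p z \<in> Sp1C \<and>
            hcU p z * hcL = hcL \<and> hcL * hcV p z = hcL) \<and>
         (\<forall>\<Phi> A B :: complex \<Rightarrow> hc.
            hc_holomorphic_on A M \<longrightarrow> hc_holomorphic_on B M \<longrightarrow>
            A ` M \<subseteq> Sp1C \<longrightarrow> B ` M \<subseteq> Sp1C \<longrightarrow>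
            (\<forall>z\<in>M. \<Phi> z = A z * hcL * B z) \<longrightarrow>
            (\<forall>z\<in>M. \<Phi> z = (A z * hcU p z) * hcL * B z) \<and>
            (\<forall>z\<in>M. \<Phi> z = A z * hcL * (hcV p z * B z)))"
proof -
  \<comment> \<open>Reassociating puts the inserted factor next to \<open>hcL\<close>, which absorbs
    it; both claims on \<open>\<Phi>\<close> are pointwise instances.\<close>
  have "a * hcU p z * hcL * b = a * hcL * b" "a * hcL * (hcV p z * b) = a * hcL * b" for z a b
    by (metis hcU_mult_hcL mult.assoc, metis hcL_mult_hcV mult.assoc)
  then show ?thesis
    by (simp add: hcU_in_Sp1C hcV_in_Sp1C hcU_mult_hcL hcL_mult_hcV)
qed

end
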